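(* Let $\gamma\in(0,1)$ and let $(X,m,T)$ be a pointwise dual ergodic measure preserving transformation with $\gamma$-regularly varying return sequence $a(n)=a_n(T)$; let $u(n)\sim\frac{\gamma a(n)}n$. Suppose that for all $C\in\mathcal F_+$, $g\in C_B(\mathbb R_+)$ and $f\in L^1_+$, $$\frac1{a(N)}\sum_{n=1}^N\left|\widehat T^n\left(1_C\,g\left(\tfrac{S_n(f)}{a(n)}\right)\right)-m(C)\,\mathbb E\big(g(m(f)W_\gamma)\big)u(n)\right|\xrightarrow[N\to\infty]{}0\quad\text{a.e.}$$ Then $(X,m,T)$ is weakly rationally ergodic, and, for some dense hereditary ring $\mathcal R$ of sets of finite measure, $$\frac1{a(N)}\sum_{n=1}^N\left|\int_{B\cap T^{-n}C}g\left(\tfrac{S_n(f)}{a(n)}\right)dm-m(B)m(C)\,\mathbb E\big(g(m(f)W_\gamma)\big)u(n)\right|\xrightarrow[N\to\infty]{}0$$ for all $B,C\in\mathcal R\cap R(T)$, $g\in C_B(\mathbb R_+)$ and $f\in L^1_+$.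
   Context: A measure preserving transformation (MPT) $(X,m,T)$ consists of a Polish space $X$ with Borel sets $\mathcal B(X)$, a non-atomic $\sigma$-finite Borel measure $m$ and a measurable $T:X\to X$ preserving $m$. $\mathcal F_+:=\{A\in\mathcal B(X):0<m(A)<\infty\}$; $L^1_+$ is the set of non-negative functions in $L^1(m)$; $m(f):=\int_Xf\,dm$; $S_n(f):=\sum_{k=0}^{n-1}f\circ T^k$; $C_B(\mathbb R_+)$ is the space of bounded continuous functions on $\mathbb R_+=[0,\infty)$. The transfer operator $\widehat T$ on $L^1(m)$ is defined by $\int\widehat Tf\cdot g\,dm=\int f\cdot g\circ T\,dm$ ($g\in L^\infty(m)$). $T$ is pointwise dual ergodic if there is a sequence $a_n(T)$ (the return sequence) with $\frac1{a_n(T)}\sum_{k=0}^{n-1}\widehat T^kf\to\int_Xf\,dm$ a.e. for all $f\in L^1(m)$. $Y_\gamma$ is the Mittag-Leffler random variable of order $\gamma$ normalized so that $\mathbb E(Y_\gamma)=1$, and $W_\gamma$ is the $\mathbb R_+$-valued random variable with $\mathbb E(g(W_\gamma))=\mathbb E(Y_\gamma g(Y_\gamma))$ for $g\in C_B(\mathbb R_+)$. A conservative ergodic MPT $(X,m,T)$ is weakly rationally ergodic if there is $F\in\mathcal F_+$ such that $$\frac1{a_n(F)}\sum_{k=0}^{n-1}m(B\cap T^{-k}C)\to m(B)m(C)\quad\text{for all measurable }B,C\subset F,\qquad(\star)$$ where $a_n(F):=\frac1{m(F)^2}\sum_{k=0}^{n-1}m(F\cap T^{-k}F)$. $R(T)$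 denotes the collection of all sets $F$ satisfying $(\star)$; it is a hereditary ring. A ring of measurable sets of finite measure is hereditary if it contains every measurable subset of each of its members, and dense if every set of finite measure can be approximated arbitrarily well, in the sense of the measure of the symmetric difference, by members of the ring. *)

theory Defs
  imports "HOL-Probability.Probability" "HOL-Library.Landau_Symbols"
begin

section \<open>Measure preserving transformations\<close>

definition non_atomic :: "'a measure \<Rightarrow> bool" where
  "non_atomic M \<longleftrightarrow> \<not> (\<exists>A\<in>sets M. 0 < emeasure M A \<and>
     (\<forall>B\<in>sets M. B \<subseteq> A \<longrightarrow> emeasure M B = 0 \<or> emeasure M (A - B) = 0))"

text \<open>
  The zero measure, for which no set of positive measure exists, is excluded.
\<close>

locale mpt = sigma_finite_measure M for M :: "'a::polish_space measure" +
  fixes T :: "'a \<Rightarrow> 'a"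
  assumes sets_eq_borel: "sets M = sets borel"
    and nonzero: "emeasure M (space M) \<noteq> 0"
    and non_atomic: "non_atomic M"
    and T_measurable: "T \<in> measurable M M"
    and T_preserves: "distr M M T = M"

definition F_plus :: "'a measure \<Rightarrow> 'a set set" where
  "F_plus M = {A \<in> sets M. 0 < emeasure M A \<and> emeasure M A < \<infinity>}"

text \<open>
  Elements of $L^1_+$ are represented by functions that are non-negative everywhere, so that
  functions defined only on $[0,\infty)$ can be composed with their Birkhoff sums.
\<close>

definition L1_plus :: "'a measure \<Rightarrow> ('a \<Rightarrow> real) set" where
  "L1_plus M = {f. integrable M f \<and> (\<forall>x\<in>space M. 0 \<le> f x)}"

definition birkhoff_sum :: "('a \<Rightarrow> 'a) \<Rightarrow> nat \<Rightarrow> ('a \<Rightarrow> real) \<Rightarrow> 'a \<Rightarrow> real" where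
  "birkhoff_sum T n f x = (\<Sum>k<n. f ((T ^^ k) x))"

text \<open>
  Bounded continuous functions on $[0,\infty)$; the values at negative arguments are irrelevant.
\<close>

definition C_B :: "(real \<Rightarrow> real) set" where
  "C_B = {g. continuous_on {0..} g \<and> bounded (g ` {0..})}"

definition conservative :: "'a measure \<Rightarrow> ('a \<Rightarrow> 'a) \<Rightarrow> bool" where
  "conservative M T \<longleftrightarrow> (\<forall>W\<in>sets M.
     disjoint_family (\<lambda>n::nat. (T ^^ n) -` W \<inter> space M) \<longrightarrow> emeasure M W = 0)"

definition ergodic :: "'a measure \<Rightarrow> ('a \<Rightarrow> 'a) \<Rightarrow> bool" where
  "ergodic M T \<longleftrightarrow> (\<forall>A\<in>sets M. T -` A \<inter> space M = A \<longrightarrow>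
     emeasure M A = 0 \<or> emeasure M (space M - A) = 0)"


section \<open>Transfer operator and pointwise dual ergodicity\<close>

definition L_infinity :: "'a measure \<Rightarrow> ('a \<Rightarrow> real) set" where
  "L_infinity M = {g \<in> borel_measurable M. \<exists>K. AE x in M. \<bar>g x\<bar> \<le> K}"

text \<open>
  The transfer operator selects a representative of an element of $L^1$ that is determined
  only up to a null set; all uses below are insensitive to the choice.
\<close>

definition transfer_op :: "'a measure \<Rightarrow> ('a \<Rightarrow> 'a) \<Rightarrow> ('a \<Rightarrow> real) \<Rightarrow> 'a \<Rightarrow> real" where
  "transfer_op M T f = (SOME h. integrable M h \<and>
     (\<forall>g\<in>L_infinity M. (LINT x|M. h x * g x) = (LINT x|M. f x * g (T x))))"

definition return_sequence :: "'a measure \<Rightarrow> ('a \<Rightarrow> 'a) \<Rightarrow> (nat \<Rightarrow> real) \<Rightarrow> bool" where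
  "return_sequence M T a \<longleftrightarrow> (\<forall>f. integrable M f \<longrightarrow>
     (AE x in M. (\<lambda>n. 1 / a n * (\<Sum>k<n. (transfer_op M T ^^ k) f x)) \<longlonglongrightarrow> (LINT x|M. f x)))"

definition pointwise_dual_ergodic :: "'a measure \<Rightarrow> ('a \<Rightarrow> 'a) \<Rightarrow> bool" where
  "pointwise_dual_ergodic M T \<longleftrightarrow> (\<exists>a. return_sequence M T a)"

definition regularly_varying :: "real \<Rightarrow> (nat \<Rightarrow> real) \<Rightarrow> bool" where
  "regularly_varying \<gamma> a \<longleftrightarrow> (\<forall>n\<ge>1. 0 < a n) \<and>
     (\<forall>c>0. (\<lambda>n. a (nat \<lfloor>c * real n\<rfloor>) / a n) \<longlonglongrightarrow> c powr \<gamma>)"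


section \<open>The limiting random variables\<close>

definition mittag_leffler :: "real \<Rightarrow> real \<Rightarrow> real" where
  "mittag_leffler \<gamma> z = (\<Sum>p. z ^ p / Gamma (1 + \<gamma> * real p))"

text \<open>
  A Mittag-Leffler variable of order \<open>\<gamma>\<close> is one whose moment generating function is the
  Mittag-Leffler function, up to a positive scale \<open>c\<close>. The normalization to
  expectation 1 forces \<open>c = Gamma (1 + \<gamma>)\<close>.
\<close>

definition normalized_mittag_leffler_rv ::
    "real \<Rightarrow> 'b measure \<Rightarrow> ('b \<Rightarrow> real) \<Rightarrow> bool" where
  "normalized_mittag_leffler_rv \<gamma> P Y \<longleftrightarrow>
     prob_space P \<and> Y \<in> borel_measurable P \<and> (\<forall>\<omega>\<in>space P. 0 \<le> Y \<omega>) \<and>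
     (\<exists>c>0. \<forall>z. integrable P (\<lambda>\<omega>. exp (z * Y \<omega>)) \<and>
        (LINT \<omega>|P. exp (z * Y \<omega>)) = mittag_leffler \<gamma> (c * z)) \<and>
     (LINT \<omega>|P. Y \<omega>) = 1"

definition size_biased_rv ::
    "'b measure \<Rightarrow> ('b \<Rightarrow> real) \<Rightarrow> 'c measure \<Rightarrow> ('c \<Rightarrow> real) \<Rightarrow> bool" where
  "size_biased_rv P Y Q W \<longleftrightarrow>
     prob_space Q \<and> W \<in> borel_measurable Q \<and> (\<forall>\<omega>\<in>space Q. 0 \<le> W \<omega>) \<and>
     (\<forall>g\<in>C_B. (LINT \<omega>|Q. g (W \<omega>)) = (LINT \<omega>|P. Y \<omega> * g (Y \<omega>)))"


section \<open>Weak rational ergodicity\<close>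

definition return_mean :: "'a measure \<Rightarrow> ('a \<Rightarrow> 'a) \<Rightarrow> 'a set \<Rightarrow> nat \<Rightarrow> real" where
  "return_mean M T F n =
     1 / (measure M F)\<^sup>2 * (\<Sum>k<n. measure M (F \<inter> (T ^^ k) -` F))"

text \<open>
  Null sets belong to \<open>R_sets M T\<close> (every term is then 0, as \<open>x / 0 = 0\<close>), in accordance with
  \<open>R_sets M T\<close> being a ring.
\<close>

definition R_sets :: "'a measure \<Rightarrow> ('a \<Rightarrow> 'a) \<Rightarrow> 'a set set" where
  "R_sets M T = {F \<in> sets M. emeasure M F < \<infinity> \<and>
     (\<forall>B\<in>sets M. \<forall>C\<in>sets M. B \<subseteq> F \<longrightarrow> C \<subseteq> F \<longrightarrow>
        (\<lambda>n. 1 / return_mean M T F n * (\<Sum>k<n. measure M (B \<inter> (T ^^ k) -` C)))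
          \<longlonglongrightarrow> measure M B * measure M C)}"

definition weakly_rationally_ergodic :: "'a measure \<Rightarrow> ('a \<Rightarrow> 'a) \<Rightarrow> bool" where
  "weakly_rationally_ergodic M T \<longleftrightarrow>
     conservative M T \<and> ergodic M T \<and> (\<exists>F\<in>F_plus M. F \<in> R_sets M T)"

definition hereditary_ring :: "'a measure \<Rightarrow> 'a set set \<Rightarrow> bool" where
  "hereditary_ring M R \<longleftrightarrow> ring_of_sets (space M) R \<and>
     (\<forall>A\<in>R. A \<in> sets M \<and> emeasure M A < \<infinity>) \<and>
     (\<forall>A\<in>R. \<forall>B\<in>sets M. B \<subseteq> A \<longrightarrow> B \<in> R)"

definition dense_ring :: "'a measure \<Rightarrow> 'a set set \<Rightarrow> bool" where
  "dense_ring M R \<longleftrightarrow> (\<forall>A\<in>sets M. emeasure M A < \<infinity> \<longrightarrow>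
     (\<forall>\<epsilon>>0. \<exists>B\<in>R. measure M ((A - B) \<union> (B - A)) < \<epsilon>))"

end

(*
  Fix an integrable h > 0. Since a is regularly varying, a(2N)/a(N) converges, so pointwise dual
  ergodicity makes sup_N 1/a(N) sum_(n<=N) That^n h finite almost everywhere. Let E_j be the set
  where this supremum is at most j and h >= 1/j. If B is a subset of E_j, then 1_B <= j h, so the
  averages 1/a(N) sum_(n<=N) That^n 1_B are bounded by j^2 on E_j. The subsets of the increasing
  sets E_j form a dense hereditary ring. By duality, integrals over B \<inter> T^(-n) C are integrals
  over C of That^n applied to functions dominated by a multiple of 1_B, so on this ring the
  almost-everywhere hypotheses integrate over C by dominated convergence; in particular every E_j of
  positive measure satisfies the condition of weak rational ergodicity.
  Conservativity: a wandering set of positive measure would force a(n) to converge to a positive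
  limit, whereas a(2n)/a(n) tends to 2^\<gamma> > 1.
*)

theory Submission
  imports Defs
begin

section \<open>Composition with bounded continuous functions on the half-line\<close>

lemma C_B_measurable_comp:
  assumes g: "g \<in> C_B" and p: "p \<in> borel_measurable M" and nn: "\<And>x. x \<in> space M \<Longrightarrow> 0 \<le> p x"
  shows "(\<lambda>x. g (p x)) \<in> borel_measurable M"
proof -
  \<comment> \<open>\<open>g\<close> is arbitrary at negative arguments, so it is replaced by a
    function that is continuous on the whole line and agrees with it on the range of
    \<open>p\<close>.\<close>
  have "continuous_on UNIV (\<lambda>t::real. g (max 0 t))"
    by (rule continuous_on_compose2[of "{0..}" g]) (use g in \<open>auto simp: C_B_def intro!: continuous_intros\<close>)
  then have "(\<lambda>t. g (max 0 t)) \<in> borel_measurable borel"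
    by (rule borel_measurable_continuous_onI)
  from measurable_compose[OF p this] show ?thesis
    by (rule measurable_cong[THEN iffD1, rotated]) (simp add: nn max_absorb2)
qed

lemma C_B_bound:
  assumes "g \<in> C_B"
  obtains K where "0 \<le> K" and "\<And>t. 0 \<le> t \<Longrightarrow> \<bar>g t\<bar> \<le> K"
proof -
  from assms obtain K where K: "\<And>t. 0 \<le> t \<Longrightarrow> \<bar>g t\<bar> \<le> K"
    by (auto simp: C_B_def bounded_iff)
  with order_trans[OF abs_ge_zero K[OF order_refl]] show thesis using that by blast
qed

section \<open>Existence, duality and positivity of the transfer operator\<close>

context mpt
begin

declare T_measurable [measurable]

lemma space_UNIV: "space M = UNIV"
  using sets_eq_imp_space_eq[OF sets_eq_borel] by simp

text \<open>\<open>M\<close> is its own image under \<open>T\<close>, so preimages of null sets are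
  null.\<close>

lemma AE_T:
  assumes "AE x in M. R x"
  shows "AE x in M. R (T x)"
  by (rule AE_distrD[OF T_measurable]) (subst T_preserves, rule assms)

lemma L_infinity_T: "g \<in> L_infinity M \<Longrightarrow> (\<lambda>x. g (T x)) \<in> L_infinity M"
  unfolding L_infinity_def by (auto dest: AE_T)

lemma L_infinity_Tn: "g \<in> L_infinity M \<Longrightarrow> (\<lambda>x. g ((T ^^ n) x)) \<in> L_infinity M"
proof (induction n)
  case (Suc n)
  from L_infinity_T[OF Suc.IH[OF Suc.prems]] show ?case
    by (simp add: funpow_swap1)
qed simp

lemma L_infinity_indicator: "A \<in> sets M \<Longrightarrow> indicator A \<in> L_infinity M"
  unfolding L_infinity_def by (auto intro!: exI[of _ 1] simp: indicator_def)

lemma integrable_mult_L_infinity: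
  assumes "integrable M f" and "g \<in> L_infinity M"
  shows "integrable M (\<lambda>x. f x * g x)"
proof -
  from assms(2) obtain K where g: "g \<in> borel_measurable M" and K: "AE x in M. \<bar>g x\<bar> \<le> K"
    unfolding L_infinity_def by auto
  show ?thesis
  proof (rule Bochner_Integration.integrable_bound)
    show "integrable M (\<lambda>x. K * f x)" using assms(1) by simp
    show "AE x in M. norm (f x * g x) \<le> norm (K * f x)"
      using K
    proof eventually_elim
      case (elim x)
      have "\<bar>f x\<bar> * \<bar>g x\<bar> \<le> \<bar>f x\<bar> * \<bar>K\<bar>" using elim by (intro mult_left_mono) auto
      then show ?case by (simp add: abs_mult mult.commute)
    qed
  qed (use assms(1) g in measurable)
qed

text \<open>The finite measure with density \<open>f\<close> is pushed forward by \<open>T\<close>.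
  Preimages of null sets are null, so the image is absolutely continuous, and its Radon-Nikodym
  density is the transfer of \<open>f\<close>.\<close>

lemma ex_transfer_nonneg:
  fixes f :: "'a \<Rightarrow> real"
  assumes f: "integrable M f" and nn: "\<And>x. 0 \<le> f x"
  shows "\<exists>h. integrable M h \<and>
    (\<forall>g\<in>L_infinity M. (LINT x|M. h x * g x) = (LINT x|M. f x * g (T x)))"
proof -
  have [measurable]: "f \<in> borel_measurable M" using f by simp
  define N where "N = distr (density M f) M T"
  have Td [measurable]: "T \<in> measurable (density M f) M" by simp
  have sN: "sets N = sets M" by (simp add: N_def)
  have "absolutely_continuous M N"
    unfolding absolutely_continuous_def
  proof
    fix A assume A: "A \<in> null_sets M"
    then have [measurable]: "A \<in> sets M" by auto
    have "AE x in M. T x \<notin> A"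
      by (rule AE_T) (use AE_not_in[OF A] in simp)
    then have "emeasure N A = 0"
      unfolding N_def
      by (subst emeasure_distr, simp, simp, subst emeasure_density)
         (auto simp: nn_integral_0_iff_AE split: split_indicator)
    then show "A \<in> null_sets N" by (auto simp: sN)
  qed
  from Radon_Nikodym[OF this sN] obtain \<phi> where
    phi [measurable]: "\<phi> \<in> borel_measurable M" and dphi: "density M \<phi> = N" by auto
  have "(\<integral>\<^sup>+x. \<phi> x \<partial>M) = emeasure N (space M)"
    by (simp add: dphi[symmetric] emeasure_density cong: nn_integral_cong)
  also have "\<dots> = (\<integral>\<^sup>+x. f x \<partial>M)"
    unfolding N_def
    using measurable_space[OF T_measurable]
    by (subst emeasure_distr, simp, simp, subst emeasure_density)
       (auto intro!: nn_integral_cong split: split_indicator)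
  also have "\<dots> < \<infinity>" using f nn by (simp add: integrable_iff_bounded)
  finally have fin: "(\<integral>\<^sup>+x. \<phi> x \<partial>M) < \<infinity>" .
  then have AEfin: "AE x in M. \<phi> x \<noteq> \<infinity>"
    by (intro nn_integral_PInf_AE) auto
  \<comment> \<open>The density \<open>\<phi>\<close> has finite total mass, hence is finite almost
    everywhere, and passing to real values changes it only on a null set.\<close>
  define h where "h = (\<lambda>x. enn2real (\<phi> x))"
  have [measurable]: "h \<in> borel_measurable M" unfolding h_def by measurable
  have eq: "AE x in M. \<phi> x = ennreal (h x)"
    using AEfin by eventually_elim (simp add: h_def less_top)
  have int_h: "integrable M h"
  proof (rule integrableI_bounded)
    have "(\<integral>\<^sup>+x. norm (h x) \<partial>M) = (\<integral>\<^sup>+x. \<phi> x \<partial>M)"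
      by (rule nn_integral_cong_AE) (use eq in eventually_elim, simp add: h_def)
    with fin show "(\<integral>\<^sup>+x. norm (h x) \<partial>M) < \<infinity>" by simp
  qed measurable
  have dh: "density M h = N"
    unfolding dphi[symmetric] by (rule density_cong) (use eq in \<open>auto elim: eventually_mono\<close>)
  have "(LINT x|M. h x * g x) = (LINT x|M. f x * g (T x))" if "g \<in> L_infinity M" for g
  proof -
    have [measurable]: "g \<in> borel_measurable M" using that by (simp add: L_infinity_def)
    have "(LINT x|M. h x * g x) = (LINT x|density M h. g x)"
      by (subst integral_density) (auto simp: h_def)
    also have "\<dots> = (LINT x|density M f. g (T x))"
      unfolding dh N_def by (subst integral_distr) auto
    also have "\<dots> = (LINT x|M. f x * g (T x))"
      by (subst integral_density) (auto simp: nn)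
    finally show ?thesis .
  qed
  with int_h show ?thesis by blast
qed

lemma ex_transfer:
  fixes f :: "'a \<Rightarrow> real"
  assumes f: "integrable M f"
  shows "\<exists>h. integrable M h \<and>
    (\<forall>g\<in>L_infinity M. (LINT x|M. h x * g x) = (LINT x|M. f x * g (T x)))"
proof -
  let ?p = "\<lambda>x. max 0 (f x)" and ?q = "\<lambda>x. max 0 (- f x)"
  have p: "integrable M ?p" and q: "integrable M ?q" using f by auto
  from ex_transfer_nonneg[OF p] obtain h where h: "integrable M h"
    "\<And>g. g \<in> L_infinity M \<Longrightarrow> (LINT x|M. h x * g x) = (LINT x|M. ?p x * g (T x))" by auto
  from ex_transfer_nonneg[OF q] obtain k where k: "integrable M k"
    "\<And>g. g \<in> L_infinity M \<Longrightarrow> (LINT x|M. k x * g x) = (LINT x|M. ?q x * g (T x))" by auto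
  have "(LINT x|M. (h x - k x) * g x) = (LINT x|M. f x * g (T x))" if g: "g \<in> L_infinity M" for g
  proof -
    note i = integrable_mult_L_infinity
    have "(LINT x|M. (h x - k x) * g x) = (LINT x|M. ?p x * g (T x)) - (LINT x|M. ?q x * g (T x))"
      using h(2)[OF g] k(2)[OF g] i[OF h(1) g] i[OF k(1) g] by (simp add: left_diff_distrib)
    also have "\<dots> = (LINT x|M. ?p x * g (T x) - ?q x * g (T x))"
      using i[OF p L_infinity_T[OF g]] i[OF q L_infinity_T[OF g]] by simp
    also have "\<dots> = (LINT x|M. f x * g (T x))"
      by (intro Bochner_Integration.integral_cong refl) (auto simp: max_def)
    finally show ?thesis .
  qed
  with h(1) k(1) show ?thesis by (intro exI[of _ "\<lambda>x. h x - k x"]) simp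
qed

text \<open>Existence makes the choice in \<open>transfer_op\<close> meaningful. Everything later
  rests on these two properties alone, hence not on the representative chosen.\<close>

lemma
  assumes "integrable M f"
  shows transfer_op_integrable: "integrable M (transfer_op M T f)"
    and transfer_op_integral: "g \<in> L_infinity M \<Longrightarrow>
      (LINT x|M. transfer_op M T f x * g x) = (LINT x|M. f x * g (T x))"
  using someI_ex[OF ex_transfer[OF assms]] unfolding transfer_op_def[symmetric] by auto

lemma transfer_pow_integrable: "integrable M f \<Longrightarrow> integrable M ((transfer_op M T ^^ n) f)"
  by (induction n) (auto intro: transfer_op_integrable)

lemma transfer_pow_integral:
  assumes f: "integrable M f" and g: "g \<in> L_infinity M"
  shows "(LINT x|M. (transfer_op M T ^^ n) f x * g x) = (LINT x|M. f x * g ((T ^^ n) x))"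
  using g
proof (induction n arbitrary: g)
  case (Suc n)
  have "(LINT x|M. (transfer_op M T ^^ Suc n) f x * g x) =
      (LINT x|M. (transfer_op M T ^^ n) f x * g (T x))"
    using transfer_op_integral[OF transfer_pow_integrable[OF f] Suc.prems] by simp
  also have "\<dots> = (LINT x|M. f x * g (T ((T ^^ n) x)))"
    by (rule Suc.IH) (rule L_infinity_T[OF Suc.prems])
  finally show ?case by simp
qed simp

text \<open>Positivity by duality: tested against the indicator of the set \<open>A\<close> where
  the inequality fails, a non-negative function gets an integral that is at most 0, so it vanishes
  almost everywhere; being positive on \<open>A\<close>, it forces \<open>A\<close> to be null. The
  scalars stand outside the operator in the conclusion, which builds the homogeneity used later into
  the statement.\<close>

lemma transfer_pow_mono:
  fixes c d :: real
  assumes f: "integrable M f" and g: "integrable M g" and le: "AE x in M. c * f x \<le> d * g x"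
  shows "AE x in M. c * (transfer_op M T ^^ n) f x \<le> d * (transfer_op M T ^^ n) g x"
proof -
  let ?f = "(transfer_op M T ^^ n) f" and ?g = "(transfer_op M T ^^ n) g"
  have If: "integrable M ?f" and Ig: "integrable M ?g"
    using f g by (auto intro: transfer_pow_integrable)
  then have [measurable]: "?f \<in> borel_measurable M" "?g \<in> borel_measurable M" by auto
  define A where "A = {x\<in>space M. d * ?g x < c * ?f x}"
  have [measurable]: "A \<in> sets M" unfolding A_def by measurable
  have L: "indicator A \<in> L_infinity M" by (rule L_infinity_indicator) measurable
  note I = integrable_mult_L_infinity[OF _ L] integrable_mult_L_infinity[OF _ L_infinity_Tn[OF L]]
  have int: "integrable M (\<lambda>x. (c * ?f x - d * ?g x) * indicator A x)"
    by (intro I) (use If Ig in simp)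
  have nn: "AE x in M. 0 \<le> (c * ?f x - d * ?g x) * indicator A x"
    by (auto simp: A_def split: split_indicator)
  have "(LINT x|M. (c * ?f x - d * ?g x) * indicator A x) =
      c * (LINT x|M. ?f x * indicator A x) - d * (LINT x|M. ?g x * indicator A x)"
    using I(1)[OF If] I(1)[OF Ig] by (simp add: left_diff_distrib mult.assoc)
  also have "\<dots> = c * (LINT x|M. f x * indicator A ((T ^^ n) x)) - d * (LINT x|M. g x * indicator A ((T ^^ n) x))"
    by (simp only: transfer_pow_integral[OF f L] transfer_pow_integral[OF g L])
  also have "\<dots> = (LINT x|M. (c * f x - d * g x) * indicator A ((T ^^ n) x))"
    using I(2)[OF f, of n] I(2)[OF g, of n] by (simp add: left_diff_distrib mult.assoc)
  also have "\<dots> = - (LINT x|M. (d * g x - c * f x) * indicator A ((T ^^ n) x))"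
    by (subst Bochner_Integration.integral_minus[symmetric]) (simp add: algebra_simps)
  also have "\<dots> \<le> 0"
    unfolding neg_le_0_iff_le
    by (rule integral_nonneg_AE) (use le in \<open>auto elim!: eventually_mono split: split_indicator\<close>)
  finally have "(LINT x|M. (c * ?f x - d * ?g x) * indicator A x) = 0"
    using integral_nonneg_AE[OF nn] by simp
  with integral_nonneg_eq_0_iff_AE[OF int nn]
  have "AE x in M. (c * ?f x - d * ?g x) * indicator A x = 0" by simp
  then show ?thesis
    using AE_space by eventually_elim (auto simp: A_def split: split_indicator_asm)
qed

lemma transfer_pow_nonneg:
  assumes "integrable M f" and "AE x in M. 0 \<le> f x"
  shows "AE x in M. 0 \<le> (transfer_op M T ^^ n) f x"
  using transfer_pow_mono[OF assms(1) assms(1), of 0 1] assms(2) by simp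

text \<open>The bridge from iterates of the operator to the correlations that occur in
  \<open>R_sets\<close>.\<close>

lemma transfer_pow_indicator:
  assumes [measurable]: "B \<in> sets M" "C \<in> sets M" and fin: "emeasure M B < \<infinity>"
  shows "(LINT x|M. (transfer_op M T ^^ n) (indicator B) x * indicator C x)
    = measure M (B \<inter> (T ^^ n) -` C)"
proof -
  have "(LINT x|M. (transfer_op M T ^^ n) (indicator B) x * indicator C x) =
      (LINT x|M. indicator B x * indicator C ((T ^^ n) x))"
    using fin by (intro transfer_pow_integral L_infinity_indicator) auto
  also have "\<dots> = (LINT x|M. indicator (B \<inter> (T ^^ n) -` C) x)"
    by (intro Bochner_Integration.integral_cong refl) (auto split: split_indicator)
  finally show ?thesis by (simp add: space_UNIV)
qed

text \<open>By sigma-finiteness. It supplies sets with integrable indicator and positive mass, to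
  which dual ergodicity can be applied.\<close>

lemma ex_subset_finite_measure:
  assumes "A \<in> sets M" and "emeasure M A \<noteq> 0"
  obtains B where "B \<in> F_plus M" and "B \<subseteq> A"
proof -
  show thesis
  proof (cases "emeasure M A = \<infinity>")
    case False
    then show thesis using assms that[of A] by (auto simp: F_plus_def zero_less_iff_neq_zero less_top)
  next
    case True
    from approx_PInf_emeasure_with_finite[OF assms(1) True, of 1] obtain B where
      "B \<in> sets M" "B \<subseteq> A" "emeasure M B < \<infinity>" "1 < emeasure M B" by auto
    then show thesis using that[of B] by (auto simp: F_plus_def intro: less_trans[OF zero_less_one])
  qed
qed

lemma ex_pos_integrable: "\<exists>h::'a \<Rightarrow> real. integrable M h \<and> (\<forall>x. 0 < h x)"
proof -
  from Ex_finite_integrable_function obtain h where h [measurable]: "h \<in> borel_measurable M"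
    and fin: "integral\<^sup>N M h \<noteq> \<infinity>" and pos: "\<And>x. 0 < h x \<and> h x < \<infinity>"
    by (auto simp: space_UNIV)
  have "integrable M (\<lambda>x. enn2real (h x))"
  proof (rule integrableI_bounded)
    have "(\<integral>\<^sup>+x. norm (enn2real (h x)) \<partial>M) = integral\<^sup>N M h"
      by (rule nn_integral_cong) (use pos in simp)
    with fin show "(\<integral>\<^sup>+x. norm (enn2real (h x)) \<partial>M) < \<infinity>" by (simp add: less_top)
  qed measurable
  with pos show ?thesis by (intro exI[of _ "\<lambda>x. enn2real (h x)"]) (auto simp: enn2real_positive_iff)
qed

end

section \<open>Pointwise dual ergodicity with a regularly varying return sequence\<close>

locale dual_ergodic_mpt = mpt +
  fixes \<gamma> :: real and a :: "nat \<Rightarrow> real"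
  assumes \<gamma>_pos: "0 < \<gamma>"
    and return_seq: "return_sequence M T a"
    and reg_var: "regularly_varying \<gamma> a"
begin

abbreviation That :: "nat \<Rightarrow> ('a \<Rightarrow> real) \<Rightarrow> 'a \<Rightarrow> real" where
  "That n \<equiv> transfer_op M T ^^ n"

lemma a_pos: "1 \<le> n \<Longrightarrow> 0 < a n"
  using reg_var by (simp add: regularly_varying_def)

lemma a_double: "(\<lambda>n. a (2 * n) / a n) \<longlonglongrightarrow> 2 powr \<gamma>"
proof -
  have "(\<lambda>n. a (nat \<lfloor>2 * real n\<rfloor>) / a n) \<longlonglongrightarrow> 2 powr \<gamma>"
    using reg_var by (simp add: regularly_varying_def)
  moreover have "nat \<lfloor>2 * real n\<rfloor> = 2 * n" for n
    using floor_of_nat[of "2 * n", where 'a = real] by simp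
  ultimately show ?thesis by simp
qed

text \<open>A positive limit would make \<open>a (2 * n) / a n\<close> tend to 1, whereas it tends
  to \<open>2 powr \<gamma>\<close>, which exceeds 1.\<close>

lemma a_not_tendsto_pos:
  assumes "0 < c"
  shows "\<not> a \<longlonglongrightarrow> c"
proof
  assume lim: "a \<longlonglongrightarrow> c"
  have "filterlim (\<lambda>n::nat. 2 * n) sequentially sequentially"
    by (rule filterlim_subseq) (simp add: strict_mono_def)
  from filterlim_compose[OF lim this] have "(\<lambda>n. a (2 * n)) \<longlonglongrightarrow> c" .
  from tendsto_divide[OF this lim] assms have "(\<lambda>n. a (2 * n) / a n) \<longlonglongrightarrow> 1" by simp
  from LIMSEQ_unique[OF this a_double] have "2 powr \<gamma> = 1" by simp
  with powr_less_mono[of 0 \<gamma> 2] \<gamma>_pos show False by simp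
qed

lemma That_tendsto:
  assumes "integrable M f"
  shows "AE x in M. (\<lambda>n. 1 / a n * (\<Sum>k<n. That k f x)) \<longlonglongrightarrow> (LINT x|M. f x)"
  using return_seq assms by (simp add: return_sequence_def)

text \<open>
  As \<open>a\<close> need not be monotone, the upper index \<open>N\<close> is absorbed by comparing with \<open>2 * N\<close>.
\<close>

lemma That_sum_bounded:
  assumes f: "integrable M f" and nn: "AE x in M. 0 \<le> f x"
  shows "AE x in M. \<exists>K. \<forall>N\<ge>1. 1 / a N * (\<Sum>n\<le>N. That n f x) \<le> K"
proof -
  have "AE x in M. \<forall>n. 0 \<le> That n f x"
    unfolding AE_all_countable by (intro allI transfer_pow_nonneg f nn)
  with That_tendsto[OF f] show ?thesis
  proof eventually_elim
    case (elim x)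
    let ?s = "\<lambda>n. 1 / a n * (\<Sum>k<n. That k f x)"
    have "filterlim (\<lambda>n::nat. 2 * n) sequentially sequentially"
      by (rule filterlim_subseq) (simp add: strict_mono_def)
    \<comment> \<open>Both factors converge, so one constant bounds the product for every index and
      not only for large ones.\<close>
    from tendsto_mult[OF a_double filterlim_compose[OF elim(1) this]]
    have "Bseq (\<lambda>n. a (2 * n) / a n * ?s (2 * n))"
      by (intro convergent_imp_Bseq convergentI)
    then obtain K where K: "\<And>n. norm (a (2 * n) / a n * ?s (2 * n)) \<le> K"
      unfolding Bseq_def by blast
    have "1 / a N * (\<Sum>n\<le>N. That n f x) \<le> K" if "1 \<le> N" for N
    proof -
      \<comment> \<open>The range up to and including \<open>N\<close> lies below
        \<open>2 * N\<close> precisely because \<open>1 \<le> N\<close>; the added terms are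
        non-negative.\<close>
      have "(\<Sum>n\<le>N. That n f x) \<le> (\<Sum>n<2 * N. That n f x)"
        using that elim(2) by (intro sum_mono2) auto
      then have "1 / a N * (\<Sum>n\<le>N. That n f x) \<le> 1 / a N * (\<Sum>n<2 * N. That n f x)"
        using a_pos[OF that] by (intro mult_left_mono) auto
      also have "\<dots> = a (2 * N) / a N * ?s (2 * N)"
        using a_pos[of "2 * N"] that by simp
      also have "\<dots> \<le> K" using K[of N] by (simp only: real_norm_def abs_le_iff)
      finally show ?thesis .
    qed
    then show ?case by blast
  qed
qed

text \<open>The function is non-negative, and by duality its integral over \<open>C\<close> is the
  measure of an empty set.\<close>

lemma That_indicator_eq_0:
  assumes B: "B \<in> sets M" "emeasure M B < \<infinity>" and C: "C \<in> sets M"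
    and disj: "B \<inter> (T ^^ n) -` C = {}"
  shows "AE x in M. x \<in> C \<longrightarrow> That n (indicator B) x = 0"
proof -
  have iB: "integrable M (indicator B :: 'a \<Rightarrow> real)" using B by simp
  have nn: "AE x in M. 0 \<le> That n (indicator B) x * indicator C x"
    using transfer_pow_nonneg[OF iB, of n] by (auto elim: eventually_mono)
  have "(LINT x|M. That n (indicator B) x * indicator C x) = 0"
    using transfer_pow_indicator[OF B(1) C B(2), of n] disj by simp
  with integral_nonneg_eq_0_iff_AE[OF _ nn]
    integrable_mult_L_infinity[OF transfer_pow_integrable[OF iB] L_infinity_indicator[OF C]]
  have "AE x in M. That n (indicator B) x * indicator C x = 0" by blast
  then show ?thesis by eventually_elim (auto split: split_indicator_asm)
qed

section \<open>Ergodicity and conservativity\<close>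

text \<open>Mass starting in a subset \<open>B\<close> of an invariant set never reaches the
  complement. The normalized sums therefore vanish there, although they tend to
  \<open>measure M B\<close>, which is positive.\<close>

lemma ergodic: "ergodic M T"
  unfolding ergodic_def
proof (intro ballI impI, rule ccontr)
  fix A assume A: "A \<in> sets M" and inv: "T -` A \<inter> space M = A"
    and "\<not> (emeasure M A = 0 \<or> emeasure M (space M - A) = 0)"
  then have A0: "emeasure M A \<noteq> 0" and D0: "emeasure M (- A) \<noteq> 0"
    by (auto simp: space_UNIV Compl_eq_Diff_UNIV)
  have D: "- A \<in> sets M" using A sets.compl_sets[OF A] by (simp add: space_UNIV Compl_eq_Diff_UNIV)
  from ex_subset_finite_measure[OF A A0] obtain B where B: "B \<in> F_plus M" "B \<subseteq> A" .
  then have Bm: "B \<in> sets M" "emeasure M B < \<infinity>" "0 < measure M B"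
    by (auto simp: F_plus_def measure_def enn2real_positive_iff)
  have inv': "T x \<in> A \<longleftrightarrow> x \<in> A" for x using inv by (auto simp: space_UNIV)
  have "(T ^^ n) x \<in> A \<longleftrightarrow> x \<in> A" for n x
    by (induction n) (auto simp: inv')
  then have "B \<inter> (T ^^ n) -` (- A) = {}" for n using B(2) by auto
  from That_indicator_eq_0[OF Bm(1,2) D this]
  have "AE x in M. \<forall>n. x \<in> - A \<longrightarrow> That n (indicator B) x = 0"
    unfolding AE_all_countable by blast
  moreover have "AE x in M. (\<lambda>n. 1 / a n * (\<Sum>k<n. That k (indicator B) x)) \<longlonglongrightarrow> measure M B"
    using That_tendsto[of "indicator B"] Bm by (simp add: space_UNIV)
  ultimately have "AE x in M. x \<notin> - A"
  proof eventually_elim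
    case (elim x)
    then show ?case using Bm(3) by (auto simp: LIMSEQ_const_iff)
  qed
  then have "emeasure M (- A) = 0" by (intro AE_iff_measurable[THEN iffD1, OF D]) (auto simp: space_UNIV)
  with D0 show False ..
qed

lemma conservative: "conservative M T"
  unfolding conservative_def
proof (intro ballI impI, rule ccontr)
  fix V assume V: "V \<in> sets M" and dis: "disjoint_family (\<lambda>n::nat. (T ^^ n) -` V \<inter> space M)"
    and "emeasure M V \<noteq> 0"
  from ex_subset_finite_measure[OF V this(3)] obtain B where B: "B \<in> F_plus M" "B \<subseteq> V" .
  then have Bm: "B \<in> sets M" "emeasure M B < \<infinity>" "0 < measure M B"
    by (auto simp: F_plus_def measure_def enn2real_positive_iff)
  have "B \<inter> (T ^^ Suc n) -` B = {}" for n
  proof -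
    have "(T ^^ 0) -` V \<inter> (T ^^ Suc n) -` V = {}"
      using disjoint_family_onD[OF dis, of 0 "Suc n"] by (simp add: space_UNIV)
    with B(2) show ?thesis by auto
  qed
  from That_indicator_eq_0[OF Bm(1,2) Bm(1) this]
  have "AE x in M. \<forall>n. x \<in> B \<longrightarrow> That (Suc n) (indicator B) x = 0"
    unfolding AE_all_countable by blast
  moreover have "AE x in M. (\<lambda>n. 1 / a n * (\<Sum>k<n. That k (indicator B) x)) \<longlonglongrightarrow> measure M B"
    using That_tendsto[of "indicator B"] Bm by (simp add: space_UNIV)
  ultimately have "AE x in M. x \<notin> B"
  proof eventually_elim
    case (elim x)
    show ?case
    proof
      assume x: "x \<in> B"
      \<comment> \<open>On \<open>B\<close> only the term \<open>k = 0\<close> survives, and it is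
        the indicator itself. Dual ergodicity then says that \<open>1 / a n\<close> tends to
        \<open>measure M B\<close>. The shift to \<open>Suc n\<close> avoids the empty sum.\<close>
      have "(\<Sum>k<Suc n. That k (indicator B) x) = 1" for n
        unfolding sum.lessThan_Suc_shift using elim(1) x by simp
      with LIMSEQ_Suc[OF elim(2)] have "(\<lambda>n. inverse (a (Suc n))) \<longlonglongrightarrow> measure M B"
        by (simp add: field_simps)
      from tendsto_inverse[OF this] Bm(3) have "(\<lambda>n. a (Suc n)) \<longlonglongrightarrow> inverse (measure M B)" by simp
      then have "a \<longlonglongrightarrow> inverse (measure M B)" by (rule LIMSEQ_imp_Suc)
      with a_not_tendsto_pos[of "inverse (measure M B)"] Bm(3) show False by simp
    qed
  qed
  then have "emeasure M B = 0" using Bm(1) by (simp add: AE_iff_measurable[OF Bm(1)] space_UNIV)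
  with Bm(3) show False by (simp add: measure_def)
qed

section \<open>Level sets on which the averages are uniformly bounded\<close>

context
  fixes h :: "'a \<Rightarrow> real"
  assumes h_integrable: "integrable M h" and h_pos: "\<And>x. 0 < h x"
begin

text \<open>The sets E_j of the overview. One parameter governs both conditions, so that the sets
  increase with \<open>j\<close>. The index \<open>N = 0\<close> is left out because
  \<open>a 0\<close> need not be positive.\<close>

definition level :: "nat \<Rightarrow> 'a set" where
  "level j = {x\<in>space M. 1 \<le> real j * h x \<and>
     (\<forall>N. 1 \<le> N \<longrightarrow> 1 / a N * (\<Sum>n\<le>N. That n h x) \<le> real j)}"

lemma level_sets [measurable]: "level j \<in> sets M"
proof -
  have [measurable]: "That n h \<in> borel_measurable M" "h \<in> borel_measurable M" for n
    using transfer_pow_integrable[OF h_integrable] h_integrable by auto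
  show ?thesis unfolding level_def by measurable
qed

lemma level_mono: "i \<le> j \<Longrightarrow> level i \<subseteq> level j"
proof
  fix x assume "i \<le> j" "x \<in> level i"
  moreover from \<open>i \<le> j\<close> have "real i * h x \<le> real j * h x"
    using h_pos[of x] by (intro mult_right_mono) auto
  ultimately show "x \<in> level j"
    unfolding level_def by (auto intro: order_trans)
qed

lemma AE_level: "AE x in M. \<exists>j. x \<in> level j"
proof -
  have "AE x in M. 0 \<le> h x" using h_pos by (simp add: less_imp_le)
  from That_sum_bounded[OF h_integrable this] AE_space show ?thesis
  proof eventually_elim
    case (elim x)
    then obtain K where K: "\<And>N. 1 \<le> N \<Longrightarrow> 1 / a N * (\<Sum>n\<le>N. That n h x) \<le> K" by blast
    \<comment> \<open>\<open>K\<close> takes care of the averages, \<open>1 / h x\<close> of the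
      lower bound on \<open>h\<close>.\<close>
    obtain j where j: "max K (1 / h x) \<le> real j" using real_arch_simple by blast
    then have "1 \<le> real j * h x" using h_pos[of x] by (simp add: field_simps)
    with K j elim(2) show ?case
      unfolding level_def by (auto intro!: exI[of _ j] intro: order_trans)
  qed
qed

text \<open>Markov's inequality: on the level the integrable function \<open>real j * h\<close> is
  at least 1.\<close>

lemma level_finite: "emeasure M (level j) < \<infinity>"
proof -
  have "integrable M (indicator (level j) :: 'a \<Rightarrow> real)"
  proof (rule Bochner_Integration.integrable_bound)
    show "integrable M (\<lambda>x. real j * h x)" using h_integrable by simp
    show "AE x in M. norm (indicator (level j) x :: real) \<le> norm (real j * h x)"
    proof (rule AE_I2)
      fix x
      have "0 \<le> real j * h x" using h_pos[of x] by simp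
      then show "norm (indicator (level j) x :: real) \<le> norm (real j * h x)"
        by (auto simp: level_def split: split_indicator)
    qed
  qed measurable
  then show ?thesis by (simp add: integrable_indicator_iff space_UNIV)
qed

lemma subset_level_finite: "B \<subseteq> level j \<Longrightarrow> emeasure M B < \<infinity>"
  using emeasure_mono[of B "level j" M] level_finite[of j] by (auto intro: le_less_trans)

text \<open>One factor \<open>real j\<close> comes from \<open>indicator B \<le> real j * h\<close>,
  carried through the positive operator, the other from the bound on the averages of
  \<open>h\<close>. Being uniform in \<open>x\<close> and \<open>N\<close>, the bound yields the
  majorants for dominated convergence.\<close>

lemma That_sum_level_bound:
  assumes B: "B \<in> sets M" "B \<subseteq> level j"
  shows "AE x in M. x \<in> level j \<longrightarrow>
    (\<forall>N. 1 \<le> N \<longrightarrow> 1 / a N * (\<Sum>n\<le>N. That n (indicator B) x) \<le> real j * real j)"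
proof -
  have "AE x in M. 1 * That n (indicator B) x \<le> real j * That n h x" for n
  proof (rule transfer_pow_mono)
    show "AE x in M. 1 * indicator B x \<le> real j * h x"
    proof (rule AE_I2)
      fix x
      have "0 \<le> real j * h x" using h_pos[of x] by simp
      with B show "1 * indicator B x \<le> real j * h x"
        by (auto simp: level_def split: split_indicator)
    qed
  qed (use B subset_level_finite h_integrable in auto)
  then have "AE x in M. \<forall>n. That n (indicator B) x \<le> real j * That n h x"
    by (simp add: AE_all_countable)
  then show ?thesis
  proof eventually_elim
    case (elim x)
    show ?case
    proof (intro impI allI)
      fix N :: nat assume x: "x \<in> level j" and N: "1 \<le> N"
      have "(\<Sum>n\<le>N. That n (indicator B) x) \<le> real j * (\<Sum>n\<le>N. That n h x)"
        unfolding sum_distrib_left by (rule sum_mono) (use elim in simp)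
      then have "1 / a N * (\<Sum>n\<le>N. That n (indicator B) x) \<le> real j * (1 / a N * (\<Sum>n\<le>N. That n h x))"
        using a_pos[OF N] by (simp add: divide_right_mono)
      also have "\<dots> \<le> real j * real j"
        using x N by (intro mult_left_mono) (auto simp: level_def)
      finally show "1 / a N * (\<Sum>n\<le>N. That n (indicator B) x) \<le> real j * real j" .
    qed
  qed
qed

section \<open>Correlations inside a level and weak rational ergodicity\<close>

text \<open>Dual ergodicity for \<open>indicator B\<close> is integrated over \<open>C\<close> by
  dominated convergence, and duality turns the integrals into correlations.\<close>

lemma correlation_tendsto:
  assumes B: "B \<in> sets M" "B \<subseteq> level j" and C: "C \<in> sets M" "C \<subseteq> level j"
  shows "(\<lambda>n. 1 / a n * (\<Sum>k<n. measure M (B \<inter> (T ^^ k) -` C))) \<longlonglongrightarrow> measure M B * measure M C"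
\<comment> \<open>The uniform bound holds from index 1 on, hence the shift.\<close>
proof (rule LIMSEQ_imp_Suc)
  note [measurable] = B(1) C(1)
  have finB: "emeasure M B < \<infinity>" and finC: "emeasure M C < \<infinity>"
    by (rule subset_level_finite[OF B(2)], rule subset_level_finite[OF C(2)])
  have iB: "integrable M (indicator B :: 'a \<Rightarrow> real)" using finB by simp
  have [measurable]: "That n (indicator B) \<in> borel_measurable M" for n
    using transfer_pow_integrable[OF iB] by auto
  note int = integrable_mult_L_infinity[OF transfer_pow_integrable[OF iB] L_infinity_indicator[OF C(1)]]
  let ?s = "\<lambda>n x. 1 / a n * (\<Sum>k<n. That k (indicator B) x * indicator C x)"
  have eq: "(LINT x|M. ?s n x) = 1 / a n * (\<Sum>k<n. measure M (B \<inter> (T ^^ k) -` C))" for n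
    using int by (simp add: transfer_pow_indicator[OF B(1) C(1) finB] del: sum_mult_indicator)
  have nn: "AE x in M. \<forall>n. 0 \<le> That n (indicator B) x"
    unfolding AE_all_countable by (intro allI transfer_pow_nonneg iB) simp
  have "(\<lambda>n. LINT x|M. ?s (Suc n) x) \<longlonglongrightarrow> (LINT x|M. measure M B * indicator C x)"
  proof (rule integral_dominated_convergence)
    show "integrable M (\<lambda>x. (real j * real j) * indicator C x)" using finC by simp
    show "AE x in M. (\<lambda>n. ?s (Suc n) x) \<longlonglongrightarrow> measure M B * indicator C x"
      using That_tendsto[OF iB]
    proof eventually_elim
      case (elim x)
      have "(LINT x|M. indicator B x) = measure M B" by (simp add: space_UNIV)
      with tendsto_mult_right[OF LIMSEQ_Suc[OF elim], of "indicator C x"] show ?case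
        by (simp only: sum_distrib_right mult.assoc)
    qed
    show "AE x in M. norm (?s (Suc n) x) \<le> (real j * real j) * indicator C x" for n
      using That_sum_level_bound[OF B] nn
    proof eventually_elim
      case (elim x)
      show ?case
      proof (cases "x \<in> C")
        case True
        \<comment> \<open>Dual ergodicity sums over \<open>k < N\<close>, the level bound over
          \<open>n \<le> N\<close>; one more non-negative term reconciles them.\<close>
        have "(\<Sum>k<Suc n. That k (indicator B) x) \<le> (\<Sum>k\<le>Suc n. That k (indicator B) x)"
          using elim(2) by (intro sum_mono2) auto
        then have "1 / a (Suc n) * (\<Sum>k<Suc n. That k (indicator B) x) \<le>
            1 / a (Suc n) * (\<Sum>k\<le>Suc n. That k (indicator B) x)"
          using a_pos[of "Suc n"] by (intro mult_left_mono) auto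
        also have "\<dots> \<le> real j * real j"
          using True C elim(1) by (auto simp del: sum.atMost_Suc)
        finally have le: "1 / a (Suc n) * (\<Sum>k<Suc n. That k (indicator B) x) \<le> real j * real j" .
        have "0 \<le> 1 / a (Suc n) * (\<Sum>k<Suc n. That k (indicator B) x)"
          using a_pos[of "Suc n"] elim(2) by (intro mult_nonneg_nonneg sum_nonneg) auto
        with le True show ?thesis by (simp del: sum.lessThan_Suc)
      qed simp
    qed
  qed measurable
  then show "(\<lambda>n. 1 / a (Suc n) * (\<Sum>k<Suc n. measure M (B \<inter> (T ^^ k) -` C)))
      \<longlonglongrightarrow> measure M B * measure M C"
    unfolding eq by (simp add: space_UNIV)
qed

text \<open>Taking both sets equal to \<open>level j\<close> in the correlation limit shows that
  \<open>return_mean\<close> is asymptotic to \<open>a\<close>, so one normalization may replace the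
  other.\<close>

lemma level_R_sets:
  assumes pos: "0 < measure M (level j)"
  shows "level j \<in> R_sets M T"
  unfolding R_sets_def
proof (intro CollectI conjI ballI impI)
  fix B C assume BC: "B \<in> sets M" "C \<in> sets M" "B \<subseteq> level j" "C \<subseteq> level j"
  let ?r = "return_mean M T (level j)"
  have "(\<lambda>n. 1 / (measure M (level j))\<^sup>2 *
      (1 / a n * (\<Sum>k<n. measure M (level j \<inter> (T ^^ k) -` level j)))) \<longlonglongrightarrow>
      1 / (measure M (level j))\<^sup>2 * (measure M (level j) * measure M (level j))"
    by (intro tendsto_mult_left correlation_tendsto) auto
  then have "(\<lambda>n. ?r n / a n) \<longlonglongrightarrow> 1"
    using pos by (simp add: return_mean_def power2_eq_square field_simps)
  from tendsto_divide[OF correlation_tendsto[OF BC(1,3,2,4)] this]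
  have "(\<lambda>n. 1 / a n * (\<Sum>k<n. measure M (B \<inter> (T ^^ k) -` C)) / (?r n / a n))
      \<longlonglongrightarrow> measure M B * measure M C" by simp
  moreover have "\<forall>\<^sub>F n in sequentially.
      1 / a n * (\<Sum>k<n. measure M (B \<inter> (T ^^ k) -` C)) / (?r n / a n) =
      1 / ?r n * (\<Sum>k<n. measure M (B \<inter> (T ^^ k) -` C))"
    using eventually_ge_at_top[of 1] by eventually_elim (use a_pos in \<open>simp add: field_simps less_imp_neq[symmetric]\<close>)
  ultimately show "(\<lambda>n. 1 / ?r n * (\<Sum>k<n. measure M (B \<inter> (T ^^ k) -` C)))
      \<longlonglongrightarrow> measure M B * measure M C"
    by (rule Lim_transform_eventually)
qed (use level_finite in auto)

text \<open>The levels cover almost every point, so if all were null the measure would be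
  zero.\<close>

lemma ex_level_pos: "\<exists>j. 0 < measure M (level j)"
proof (rule ccontr)
  assume neg: "\<not> ?thesis"
  have "AE x in M. x \<notin> level j" for j
  proof (rule AE_not_in)
    from neg have "measure M (level j) = 0" by (simp add: zero_less_measure_iff)
    with level_finite[of j] have "emeasure M (level j) = 0"
      by (auto simp: measure_def enn2real_eq_0_iff)
    then show "level j \<in> null_sets M" by auto
  qed
  then have "AE x in M. \<forall>j. x \<notin> level j" by (simp add: AE_all_countable)
  with AE_level have "AE x in M. False" by eventually_elim blast
  then show False using nonzero by (simp add: AE_iff_measurable[OF sets.top])
qed

lemma weakly_rationally_ergodic: "weakly_rationally_ergodic M T"
proof -
  from ex_level_pos obtain j where j: "0 < measure M (level j)" ..
  then have "level j \<in> F_plus M"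
    using level_finite[of j] by (auto simp: F_plus_def measure_def enn2real_positive_iff)
  with level_R_sets[OF j] show ?thesis
    using conservative ergodic by (auto simp: weakly_rationally_ergodic_def)
qed

section \<open>The dense hereditary ring\<close>

definition level_ring :: "'a set set" where
  "level_ring = {A \<in> sets M. \<exists>j. A \<subseteq> level j}"

text \<open>Levels increase, so the larger index serves both sets; the integration argument needs
  \<open>B\<close> and \<open>C\<close> inside one level.\<close>

lemma level_ring_subset_pair:
  assumes "A \<in> level_ring" "B \<in> level_ring"
  obtains j where "A \<subseteq> level j" "B \<subseteq> level j"
proof -
  from assms obtain i j where "A \<subseteq> level i" "B \<subseteq> level j" by (auto simp: level_ring_def)
  then show thesis using level_mono[of i "max i j"] level_mono[of j "max i j"] that[of "max i j"] by auto
qed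

lemma hereditary_level_ring: "hereditary_ring M level_ring"
  unfolding hereditary_ring_def
proof (intro conjI ballI impI)
  show "ring_of_sets (space M) level_ring"
  proof (rule ring_of_setsI)
    fix A B assume AB: "A \<in> level_ring" "B \<in> level_ring"
    from level_ring_subset_pair[OF this] obtain j where "A \<subseteq> level j" "B \<subseteq> level j" .
    with AB show "A \<union> B \<in> level_ring" and "A - B \<in> level_ring"
      unfolding level_ring_def by (auto intro!: exI[of _ j])
  qed (auto simp: level_ring_def space_UNIV)
  fix A assume "A \<in> level_ring"
  then obtain j where "A \<in> sets M" "A \<subseteq> level j" by (auto simp: level_ring_def)
  then show "A \<in> sets M" and "emeasure M A < \<infinity>" by (simp, intro subset_level_finite)
qed (auto simp: level_ring_def)

lemma dense_level_ring: "dense_ring M level_ring"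
  unfolding dense_ring_def
proof (intro ballI impI allI)
  fix A and \<epsilon> :: real assume A [measurable]: "A \<in> sets M" and fin: "emeasure M A < \<infinity>" and eps: "0 < \<epsilon>"
  \<comment> \<open>The approximants are \<open>A \<inter> level j\<close>. The remainders decrease
    to a null set, and finiteness of \<open>emeasure M A\<close> permits continuity from
    above.\<close>
  have "(\<lambda>j. measure M (A - level j)) \<longlonglongrightarrow> measure M (\<Inter>j. A - level j)"
  proof (rule Lim_measure_decseq)
    show "decseq (\<lambda>j. A - level j)" using level_mono by (fastforce simp: decseq_def)
    show "emeasure M (A - level j) \<noteq> \<infinity>" for j
      using emeasure_mono[of "A - level j" A M] fin by (auto simp: less_top[symmetric] top_unique)
  qed auto
  moreover have "emeasure M (\<Inter>j. A - level j) = 0"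
  proof (rule AE_iff_measurable[THEN iffD1])
    show "AE x in M. x \<notin> (\<Inter>j. A - level j)" using AE_level by eventually_elim blast
  qed (auto simp: space_UNIV)
  ultimately have "(\<lambda>j. measure M (A - level j)) \<longlonglongrightarrow> 0" by (simp add: measure_def)
  from order_tendstoD(2)[OF this eps] obtain j where "measure M (A - level j) < \<epsilon>"
    by (auto simp: eventually_sequentially)
  moreover have "(A - A \<inter> level j) \<union> (A \<inter> level j - A) = A - level j" by auto
  ultimately show "\<exists>B\<in>level_ring. measure M ((A - B) \<union> (B - A)) < \<epsilon>"
    by (intro bexI[of _ "A \<inter> level j"]) (auto simp: level_ring_def)
qed

section \<open>Integrating the almost-everywhere convergence\<close>

text \<open>Dominated convergence over \<open>C\<close>, followed by the triangle inequality for
  integrals. In the application \<open>\<phi> n\<close> is the indicator of \<open>B\<close> times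
  \<open>g\<close> of the normalized Birkhoff sum, and \<open>D\<close> is
  \<open>measure M B\<close> times the expectation of the limit.\<close>

lemma integrated_convergence:
  fixes D K U :: real and u :: "nat \<Rightarrow> real" and \<phi> :: "nat \<Rightarrow> 'a \<Rightarrow> real"
  assumes B: "B \<in> sets M" "B \<subseteq> level j" and C: "C \<in> sets M" "C \<subseteq> level j"
    and \<phi>: "\<And>n. 1 \<le> n \<Longrightarrow> \<phi> n \<in> borel_measurable M"
    and K: "\<And>n x. 1 \<le> n \<Longrightarrow> \<bar>\<phi> n x\<bar> \<le> K * indicator B x"
    and U: "\<And>N. 1 \<le> N \<Longrightarrow> 1 / a N * (\<Sum>n=1..N. \<bar>u n\<bar>) \<le> U"
    and lim: "AE x in M. (\<lambda>N. 1 / a N * (\<Sum>n=1..N. \<bar>That n (\<phi> n) x - D * u n\<bar>)) \<longlonglongrightarrow> 0"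
  shows "(\<lambda>N. 1 / a N * (\<Sum>n=1..N.
    \<bar>(LINT x|M. \<phi> n x * indicator C ((T ^^ n) x)) - D * measure M C * u n\<bar>)) \<longlonglongrightarrow> 0"
proof -
  have finB: "emeasure M B < \<infinity>" and finC: "emeasure M C < \<infinity>"
    by (rule subset_level_finite[OF B(2)], rule subset_level_finite[OF C(2)])
  have iB: "integrable M (indicator B :: 'a \<Rightarrow> real)" and iC: "integrable M (indicator C :: 'a \<Rightarrow> real)"
    using B C finB finC by auto
  have i\<phi>: "integrable M (\<phi> n)" if "1 \<le> n" for n
  proof (rule Bochner_Integration.integrable_bound)
    show "integrable M (\<lambda>x. K * indicator B x)" using iB by simp
    show "AE x in M. norm (\<phi> n x) \<le> norm (K * indicator B x)"
      using order_trans[OF K[OF that] abs_ge_self] by simp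
  qed (rule \<phi>[OF that])
  let ?d = "\<lambda>n x. (That n (\<phi> n) x - D * u n) * indicator C x"
  have id: "integrable M (?d n)" if "1 \<le> n" for n
    unfolding left_diff_distrib using iC
      integrable_mult_L_infinity[OF transfer_pow_integrable[OF i\<phi>[OF that]] L_infinity_indicator[OF C(1)]]
    by simp
  let ?s = "\<lambda>N x. 1 / a N * (\<Sum>n=1..N. \<bar>?d n x\<bar>)"
  have int_s: "integrable M (?s N)" for N
    by (intro integrable_mult_right Bochner_Integration.integrable_sum integrable_abs id) auto
  \<comment> \<open>Monotonicity applied to \<open>\<phi> n\<close> with the scalars 1 and -1 bounds
    the absolute value.\<close>
  have dom: "AE x in M. \<bar>That n (\<phi> n) x\<bar> \<le> K * That n (indicator B) x" if "1 \<le> n" for n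
  proof -
    have "AE x in M. 1 * That n (\<phi> n) x \<le> K * That n (indicator B) x"
      using K[OF that] by (intro transfer_pow_mono i\<phi> iB that) (auto simp: abs_le_iff)
    moreover have "AE x in M. (-1) * That n (\<phi> n) x \<le> K * That n (indicator B) x"
      using K[OF that] by (intro transfer_pow_mono i\<phi> iB that) (auto simp: abs_le_iff)
    ultimately show ?thesis by eventually_elim (auto simp: abs_le_iff)
  qed
  then have dom: "AE x in M. \<forall>n. 1 \<le> n \<longrightarrow> \<bar>That n (\<phi> n) x\<bar> \<le> K * That n (indicator B) x"
    by (simp add: AE_all_countable)
  have nn: "AE x in M. \<forall>n. 0 \<le> That n (indicator B) x"
    unfolding AE_all_countable by (intro allI transfer_pow_nonneg iB) simp
  have "(\<lambda>N. LINT x|M. ?s (Suc N) x) \<longlonglongrightarrow> (LINT x|M. 0)"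
  proof (rule integral_dominated_convergence)
    \<comment> \<open>In the majorant the first summand bounds the averages of
      \<open>That n (\<phi> n)\<close> on the level, the second those of \<open>D * u n\<close>.
      \<open>K\<close> enters with its absolute value since its sign is not assumed.\<close>
    show "integrable M (\<lambda>x. (\<bar>K\<bar> * (real j * real j) + \<bar>D\<bar> * U) * indicator C x)" using iC by simp
    show "AE x in M. (\<lambda>N. ?s (Suc N) x) \<longlonglongrightarrow> 0"
      using lim
    proof eventually_elim
      case (elim x)
      from tendsto_mult_right[OF LIMSEQ_Suc[OF elim], of "indicator C x"] show ?case
        by (simp add: abs_mult sum_distrib_right[symmetric] mult.assoc del: sum.cl_ivl_Suc)
    qed
    show "AE x in M. norm (?s (Suc N) x) \<le> (\<bar>K\<bar> * (real j * real j) + \<bar>D\<bar> * U) * indicator C x" for N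
      using That_sum_level_bound[OF B] nn dom
    proof eventually_elim
      case (elim x)
      define N' where "N' = Suc N"
      have N': "1 \<le> N'" and aN: "0 < a N'" using a_pos[of N'] by (auto simp: N'_def)
      show ?case unfolding N'_def[symmetric]
      proof (cases "x \<in> C")
        case True
        let ?S = "\<Sum>n\<le>N'. That n (indicator B) x" and ?V = "\<Sum>n=1..N'. \<bar>u n\<bar>"
        have "(\<Sum>n=1..N'. \<bar>?d n x\<bar>) \<le>
            (\<Sum>n=1..N'. \<bar>K\<bar> * That n (indicator B) x + \<bar>D\<bar> * \<bar>u n\<bar>)"
        proof (rule sum_mono)
          fix n assume "n \<in> {1..N'}"
          then have "\<bar>That n (\<phi> n) x\<bar> \<le> K * That n (indicator B) x" using elim(3) by simp
          also have "\<dots> \<le> \<bar>K\<bar> * That n (indicator B) x"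
            using elim(2) by (intro mult_right_mono) auto
          finally show "\<bar>?d n x\<bar> \<le> \<bar>K\<bar> * That n (indicator B) x + \<bar>D\<bar> * \<bar>u n\<bar>"
            using True abs_triangle_ineq4[of "That n (\<phi> n) x" "D * u n"] by (simp add: abs_mult)
        qed
        also have "\<dots> = \<bar>K\<bar> * (\<Sum>n=1..N'. That n (indicator B) x) + \<bar>D\<bar> * ?V"
          by (simp add: sum.distrib sum_distrib_left)
        \<comment> \<open>The non-negative term at \<open>n = 0\<close> is added to reach the range
          of the level bound.\<close>
        also have "\<dots> \<le> \<bar>K\<bar> * ?S + \<bar>D\<bar> * ?V"
          using elim(2) by (intro add_right_mono mult_left_mono sum_mono2) auto
        finally have "?s N' x \<le> 1 / a N' * (\<bar>K\<bar> * ?S + \<bar>D\<bar> * ?V)"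
          using aN by (intro mult_left_mono) auto
        also have "\<dots> = \<bar>K\<bar> * (1 / a N' * ?S) + \<bar>D\<bar> * (1 / a N' * ?V)"
          by (simp add: algebra_simps add_divide_distrib)
        also have "\<dots> \<le> \<bar>K\<bar> * (real j * real j) + \<bar>D\<bar> * U"
          using elim(1) True C N' U[OF N'] by (intro add_mono mult_left_mono) auto
        finally have "?s N' x \<le> \<bar>K\<bar> * (real j * real j) + \<bar>D\<bar> * U" .
        moreover have "0 \<le> ?s N' x" using aN by (intro mult_nonneg_nonneg sum_nonneg) auto
        ultimately show "norm (?s N' x) \<le> (\<bar>K\<bar> * (real j * real j) + \<bar>D\<bar> * U) * indicator C x"
          using True by (simp only: real_norm_def abs_of_nonneg indicator_simps mult_1_right)
      qed simp
    qed
    show "?s (Suc N) \<in> borel_measurable M" for N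
      by (rule borel_measurable_integrable[OF int_s])
  qed simp
  then have lim': "(\<lambda>N. LINT x|M. ?s N x) \<longlonglongrightarrow> 0"
    by (intro LIMSEQ_imp_Suc[of "\<lambda>N. LINT x|M. ?s N x"]) simp
  show ?thesis
  \<comment> \<open>The target lies between 0 and the integral of \<open>?s N\<close>: each of its
    terms is the absolute value of the integral of \<open>?d n\<close>.\<close>
  proof (rule tendsto_sandwich[OF _ _ tendsto_const lim'])
    show "\<forall>\<^sub>F N in sequentially. 0 \<le> 1 / a N * (\<Sum>n=1..N.
        \<bar>(LINT x|M. \<phi> n x * indicator C ((T ^^ n) x)) - D * measure M C * u n\<bar>)"
      using eventually_ge_at_top[of 1]
    proof eventually_elim
      case (elim N)
      show ?case using a_pos[OF elim] by (intro mult_nonneg_nonneg sum_nonneg) auto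
    qed
    show "\<forall>\<^sub>F N in sequentially. 1 / a N * (\<Sum>n=1..N.
        \<bar>(LINT x|M. \<phi> n x * indicator C ((T ^^ n) x)) - D * measure M C * u n\<bar>) \<le> (LINT x|M. ?s N x)"
      using eventually_ge_at_top[of 1]
    proof eventually_elim
      case (elim N)
      have "(\<Sum>n=1..N. \<bar>(LINT x|M. \<phi> n x * indicator C ((T ^^ n) x)) - D * measure M C * u n\<bar>)
          \<le> (\<Sum>n=1..N. LINT x|M. \<bar>?d n x\<bar>)"
      proof (rule sum_mono)
        fix n assume "n \<in> {1..N}"
        then have n: "1 \<le> n" by simp
        note L = L_infinity_indicator[OF C(1)]
        have "(LINT x|M. \<phi> n x * indicator C ((T ^^ n) x)) = (LINT x|M. That n (\<phi> n) x * indicator C x)"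
          by (rule transfer_pow_integral[OF i\<phi>[OF n] L, symmetric])
        then have "(LINT x|M. \<phi> n x * indicator C ((T ^^ n) x)) - D * measure M C * u n = (LINT x|M. ?d n x)"
          unfolding left_diff_distrib
          using iC integrable_mult_L_infinity[OF transfer_pow_integrable[OF i\<phi>[OF n]] L]
          by (simp add: space_UNIV)
        then show "\<bar>(LINT x|M. \<phi> n x * indicator C ((T ^^ n) x)) - D * measure M C * u n\<bar>
            \<le> (LINT x|M. \<bar>?d n x\<bar>)"
          by (simp only: integral_abs_bound)
      qed
      then have "1 / a N * (\<Sum>n=1..N. \<bar>(LINT x|M. \<phi> n x * indicator C ((T ^^ n) x)) - D * measure M C * u n\<bar>)
          \<le> 1 / a N * (\<Sum>n=1..N. LINT x|M. \<bar>?d n x\<bar>)"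
        using a_pos[OF elim] by (intro mult_left_mono) auto
      also have "\<dots> = (LINT x|M. ?s N x)"
        by (subst integral_mult_right_zero, subst Bochner_Integration.integral_sum) (auto intro!: integrable_abs id)
      finally show ?case .
    qed
  qed
qed

end

section \<open>Boundedness of the averages of \<open>u\<close>\<close>

text \<open>
  The hypothesis itself, at a single good point, bounds the averages of \<open>u\<close>; this replaces
  Karamata's theorem for \<open>u \<sim> \<gamma> a(n) / n\<close>.
\<close>

lemma renewal_sequence_bound:
  assumes C: "C \<in> F_plus M"
    and lim: "AE x in M. (\<lambda>N. 1 / a N * (\<Sum>n=1..N. \<bar>That n (indicator C) x - measure M C * u n\<bar>)) \<longlonglongrightarrow> 0"
  obtains U where "\<And>N. 1 \<le> N \<Longrightarrow> 1 / a N * (\<Sum>n=1..N. \<bar>u n\<bar>) \<le> U"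
proof -
  have Cm: "C \<in> sets M" "emeasure M C < \<infinity>" "0 < measure M C"
    using C by (auto simp: F_plus_def measure_def enn2real_positive_iff)
  let ?l = "\<lambda>N x. 1 / a N * (\<Sum>n=1..N. \<bar>That n (indicator C) x - measure M C * u n\<bar>)"
  have iC: "integrable M (indicator C :: 'a \<Rightarrow> real)" using Cm by simp
  have nn: "AE x in M. \<forall>n. 0 \<le> That n (indicator C) x"
    unfolding AE_all_countable by (intro allI transfer_pow_nonneg iC) simp
  have "AE x in M. \<exists>K. \<forall>N\<ge>1. 1 / a N * (\<Sum>n\<le>N. That n (indicator C) x) \<le> K"
    by (intro That_sum_bounded iC) simp
  with lim nn have ae: "AE x in M. (\<lambda>N. ?l N x) \<longlonglongrightarrow> 0 \<and> (\<forall>n. 0 \<le> That n (indicator C) x) \<and>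
      (\<exists>K. \<forall>N\<ge>1. 1 / a N * (\<Sum>n\<le>N. That n (indicator C) x) \<le> K)"
    by eventually_elim blast
  \<comment> \<open>Since the measure is nonzero, some point has all three almost-everywhere
    properties at once.\<close>
  have "\<not> (AE x in M. False)" using nonzero by (simp add: AE_iff_measurable[OF sets.top])
  then have "ae_filter M \<noteq> bot" unfolding eventually_False .
  from eventually_happens'[OF this ae] obtain x K where l: "(\<lambda>N. ?l N x) \<longlonglongrightarrow> 0" and nn: "\<And>n. 0 \<le> That n (indicator C) x"
    and K: "\<And>N. 1 \<le> N \<Longrightarrow> 1 / a N * (\<Sum>n\<le>N. That n (indicator C) x) \<le> K"
    by blast
  from convergent_imp_Bseq[OF convergentI[OF l]] obtain L where "\<And>N. norm (?l N x) \<le> L"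
    unfolding Bseq_def by blast
  then have L: "?l N x \<le> L" for N unfolding real_norm_def by (rule order_trans[OF abs_ge_self])
  \<comment> \<open>By the triangle inequality \<open>measure M C * \<bar>u n\<bar>\<close> is at
    most the deviation plus the iterate at the point; the averages of these are bounded by
    \<open>L\<close> and \<open>K\<close>.\<close>
  have "1 / a N * (\<Sum>n=1..N. \<bar>u n\<bar>) \<le> (L + K) / measure M C" if N: "1 \<le> N" for N
  proof -
    have "measure M C * (\<Sum>n=1..N. \<bar>u n\<bar>) \<le>
        (\<Sum>n=1..N. \<bar>That n (indicator C) x - measure M C * u n\<bar> + That n (indicator C) x)"
      unfolding sum_distrib_left
    proof (rule sum_mono)
      fix n
      have "measure M C * \<bar>u n\<bar> = \<bar>measure M C * u n\<bar>" by (simp add: abs_mult)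
      then show "measure M C * \<bar>u n\<bar> \<le> \<bar>That n (indicator C) x - measure M C * u n\<bar> + That n (indicator C) x"
        using nn[of n] by linarith
    qed
    also have "\<dots> \<le> (\<Sum>n=1..N. \<bar>That n (indicator C) x - measure M C * u n\<bar>) + (\<Sum>n\<le>N. That n (indicator C) x)"
      unfolding sum.distrib using nn by (intro add_left_mono sum_mono2) auto
    finally have "1 / a N * (measure M C * (\<Sum>n=1..N. \<bar>u n\<bar>)) \<le>
        ?l N x + 1 / a N * (\<Sum>n\<le>N. That n (indicator C) x)"
      unfolding distrib_left[symmetric] using a_pos[OF N] by (intro mult_left_mono) auto
    also have "\<dots> \<le> L + K" by (intro add_mono L K N)
    finally show ?thesis using Cm(3) by (simp add: field_simps)
  qed
  then show thesis by (rule that)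
qed

end

section \<open>Convergence of integrals on the ring of subsets of levels\<close>

theorem theorem6p2:
  fixes M :: "'a::polish_space measure" and T :: "'a \<Rightarrow> 'a"
    and \<gamma> :: real and a u :: "nat \<Rightarrow> real"
    and P :: "'b measure" and Y :: "'b \<Rightarrow> real"
    and Q :: "'c measure" and W :: "'c \<Rightarrow> real"
  assumes "0 < \<gamma>" and "\<gamma> < 1"
    and "mpt M T"
    and "pointwise_dual_ergodic M T"
    and "return_sequence M T a"
    and "regularly_varying \<gamma> a"
    and "u \<sim>[sequentially] (\<lambda>n. \<gamma> * a n / real n)"
    and "normalized_mittag_leffler_rv \<gamma> P Y"
    and "size_biased_rv P Y Q W"
    and "\<And>C g f. C \<in> F_plus M \<Longrightarrow> g \<in> C_B \<Longrightarrow> f \<in> L1_plus M \<Longrightarrow>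
      AE x in M. (\<lambda>N. 1 / a N * (\<Sum>n=1..N.
        \<bar>(transfer_op M T ^^ n) (\<lambda>y. indicator C y * g (birkhoff_sum T n f y / a n)) x
          - measure M C * (LINT \<omega>|Q. g ((LINT y|M. f y) * W \<omega>)) * u n\<bar>)) \<longlonglongrightarrow> 0"
  shows "weakly_rationally_ergodic M T \<and>
    (\<exists>R. hereditary_ring M R \<and> dense_ring M R \<and>
      (\<forall>B \<in> R \<inter> R_sets M T. \<forall>C \<in> R \<inter> R_sets M T. \<forall>g \<in> C_B. \<forall>f \<in> L1_plus M.
        (\<lambda>N. 1 / a N * (\<Sum>n=1..N.
          \<bar>(LINT x : B \<inter> (T ^^ n) -` C | M. g (birkhoff_sum T n f x / a n))
            - measure M B * measure M C * (LINT \<omega>|Q. g ((LINT y|M. f y) * W \<omega>)) * u n\<bar>)) \<longlonglongrightarrow> 0))"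
proof -
  interpret dual_ergodic_mpt M T \<gamma> a
    using assms by (intro dual_ergodic_mpt.intro dual_ergodic_mpt_axioms.intro)
  interpret Q: prob_space Q using assms(9) by (simp add: size_biased_rv_def)
  from ex_pos_integrable obtain h :: "'a \<Rightarrow> real" where h: "integrable M h" "\<And>x. 0 < h x" by blast
  have top: "emeasure M (space M) \<noteq> 0" by (rule nonzero)
  from ex_subset_finite_measure[OF sets.top top] obtain F where F: "F \<in> F_plus M" .
  \<comment> \<open>The hypothesis with \<open>g\<close> constantly 1 and \<open>f\<close> zero: the
    expectation is 1 because \<open>Q\<close> is a probability measure.\<close>
  have "AE x in M. (\<lambda>N. 1 / a N * (\<Sum>n=1..N. \<bar>That n (indicator F) x - measure M F * u n\<bar>)) \<longlonglongrightarrow> 0"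
    using assms(10)[OF F, of "\<lambda>_. 1" "\<lambda>_. 0"]
    by (auto simp: C_B_def L1_plus_def Q.prob_space bounded_iff)
  from renewal_sequence_bound[OF F this] obtain U where
    U: "\<And>N. 1 \<le> N \<Longrightarrow> 1 / a N * (\<Sum>n=1..N. \<bar>u n\<bar>) \<le> U" by blast
  show ?thesis
  proof (intro conjI exI[of _ "level_ring h"] ballI)
    show "weakly_rationally_ergodic M T" by (rule weakly_rationally_ergodic[OF h])
    show "hereditary_ring M (level_ring h)" by (rule hereditary_level_ring[OF h])
    show "dense_ring M (level_ring h)" by (rule dense_level_ring[OF h])
    fix B C g f
    assume BC: "B \<in> level_ring h \<inter> R_sets M T" "C \<in> level_ring h \<inter> R_sets M T"
      and g: "g \<in> C_B" and f: "f \<in> L1_plus M"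
    have Bs [measurable]: "B \<in> sets M" and Cs: "C \<in> sets M"
      using BC by (auto simp: level_ring_def[OF h])
    from BC obtain j where j: "B \<subseteq> level h j" "C \<subseteq> level h j"
      by (auto elim: level_ring_subset_pair[OF h])
    have f_meas [measurable]: "f \<in> borel_measurable M" and f_nn: "\<And>x. 0 \<le> f x"
      using f by (auto simp: L1_plus_def space_UNIV)
    from C_B_bound[OF g] obtain K where K: "0 \<le> K" "\<And>t. 0 \<le> t \<Longrightarrow> \<bar>g t\<bar> \<le> K" by blast
    define \<phi> where "\<phi> n y = indicator B y * g (birkhoff_sum T n f y / a n)" for n y
    define E where "E = (LINT \<omega>|Q. g ((LINT y|M. f y) * W \<omega>))"
    \<comment> \<open>Non-negativity keeps the arguments in the half-line where \<open>g\<close> is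
      controlled; \<open>1 \<le> n\<close> is required because the sign of \<open>a 0\<close> is
      unknown.\<close>
    have S_nn: "0 \<le> birkhoff_sum T n f x / a n" if "1 \<le> n" for n x
      unfolding birkhoff_sum_def using a_pos[OF that] f_nn by (intro divide_nonneg_pos sum_nonneg) auto
    have [measurable]: "birkhoff_sum T n f \<in> borel_measurable M" for n
      unfolding birkhoff_sum_def[abs_def] by measurable
    have \<phi>_meas: "\<phi> n \<in> borel_measurable M" if "1 \<le> n" for n
    proof -
      have "(\<lambda>y. g (birkhoff_sum T n f y / a n)) \<in> borel_measurable M"
        by (rule C_B_measurable_comp[OF g _ S_nn[OF that]]) measurable
      then show ?thesis unfolding \<phi>_def[abs_def] by measurable
    qed
    have \<phi>_le: "\<bar>\<phi> n x\<bar> \<le> K * indicator B x" if "1 \<le> n" for n x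
      using K(2)[OF S_nn[OF that, of x]] by (auto simp: \<phi>_def split: split_indicator)
    have eq: "(LINT x : B \<inter> (T ^^ n) -` C | M. g (birkhoff_sum T n f x / a n))
        = (LINT x|M. \<phi> n x * indicator C ((T ^^ n) x))" for n
      unfolding set_lebesgue_integral_def
      by (intro Bochner_Integration.integral_cong refl) (auto simp: \<phi>_def split: split_indicator)
    \<comment> \<open>Here \<open>B\<close> takes the place of the set \<open>C\<close> of the
      hypothesis; the present \<open>C\<close> enters as the set over which one integrates.\<close>
    have lim: "AE x in M. (\<lambda>N. 1 / a N * (\<Sum>n=1..N. \<bar>That n (\<phi> n) x - (measure M B * E) * u n\<bar>)) \<longlonglongrightarrow> 0"
      if "B \<in> F_plus M"
      using assms(10)[OF that g f] by (simp only: \<phi>_def[abs_def] E_def)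
    have "(\<lambda>N. 1 / a N * (\<Sum>n=1..N. \<bar>(LINT x|M. \<phi> n x * indicator C ((T ^^ n) x))
        - (measure M B * E) * measure M C * u n\<bar>)) \<longlonglongrightarrow> 0"
    \<comment> \<open>A null set \<open>B\<close> is outside \<open>F_plus M\<close>, so the
      hypothesis does not cover it; then the integrals and the limit terms are all zero.\<close>
    proof (cases "emeasure M B = 0")
      case False
      then have "B \<in> F_plus M"
        using Bs subset_level_finite[OF h j(1)] by (auto simp: F_plus_def zero_less_iff_neq_zero)
      from integrated_convergence[OF h Bs j(1) Cs j(2) \<phi>_meas \<phi>_le U lim[OF this]]
      show ?thesis .
    next
      case True
      then have ae: "AE x in M. x \<notin> B" by (intro AE_not_in) auto
      have "(LINT x|M. \<phi> n x * indicator C ((T ^^ n) x)) = 0" for n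
        by (rule integral_eq_zero_AE) (use ae in \<open>eventually_elim, simp add: \<phi>_def\<close>)
      with True show ?thesis by (simp add: measure_def)
    qed
    then show "(\<lambda>N. 1 / a N * (\<Sum>n=1..N.
        \<bar>(LINT x : B \<inter> (T ^^ n) -` C | M. g (birkhoff_sum T n f x / a n))
          - measure M B * measure M C * (LINT \<omega>|Q. g ((LINT y|M. f y) * W \<omega>)) * u n\<bar>)) \<longlonglongrightarrow> 0"
      unfolding eq E_def by (simp only: mult.commute mult.left_commute mult.assoc)
  qed
qed

end
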